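(* For every instance of the $p$-center problem, $v(\overline{CP_1})=v(\overline{P_2})$; that is, the linear relaxations of the formulations $(CP_1)$ and $(P_2)$ have the same optimal value.
   Context: An instance of the $p$-center problem consists of positive integers $N$ (number of clients $C_1,\dots,C_N$), $M$ (number of potential facility sites $F_1,\dots,F_M$) and $p$, and of distances $d_{ij}\ge 0$ between client $C_i$ and site $F_j$ for $i\in\mathcal N=\{1,\dots,N\}$, $j\in\mathcal M=\{1,\dots,M\}$. Let $D^0<D^1<\dots<D^K$ be the distinct values taken by the $d_{ij}$, with $K\ge 1$, and $\mathcal K=\{1,\dots,K\}$. For $i\in\mathcal N$ and $k\in\mathcal K$, let $N_i^k$ be the set of facilities located at distance less than $D^k$ from client $C_i$, i.e. those with $d_{ij}<D^k$. Let $S_i$ be the set of indices $k\in\{1,\dots,K-1\}$ such that $N_i^k\ne N_i^{k+1}$. Formulation $(P_2)$ is the 0-1 program with variables $y_j$ ($j\in\mathcal M$) and $z^k$ ($k\in\mathcal K$): $$\min\ D^0+\sum_{k=1}^K (D^k-D^{k-1})\,z^k$$ subject to $$1\le \sum_{j=1}^M y_j\le p,\qquad z^k+\sum_{j\,:\,d_{ij}<D^k} y_j\ge 1\quad (i\in\mathcal N,\ k\in\mathcal K),\qquad y_j,z^k\in\{0,1\}\quad (j\in\mathcal M,\ k\in\mathcal K).$$ Formulation $(CP_1)$ is the 0-1 program with the same variables and the same objective, subject to $$1\le \sum_{j=1}^M y_j\le p,\qquad z^k\ge z^{k+1}\quad (k\in\{1,\dots,K-1\}),$$ $$z^k+\sum_{j\,:\,d_{ij}<D^k}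 y_j\ge 1\quad (i\in\mathcal N,\ k\in S_i\cup\{K\}),\qquad y_j,z^k\in\{0,1\}\quad (j\in\mathcal M,\ k\in\mathcal K).$$ For a formulation $F$, $\overline F$ denotes its linear relaxation (each constraint $y_j,z^k\in\{0,1\}$ is replaced by $y_j,z^k\in[0,1]$), and $v(\overline F)$ denotes the optimal value of $\overline F$. *)

theory Defs
  imports "HOL-Library.Extended_Real"
begin

(* Clients and sites are identified with their indices in {1..N} and {1..M}; the values of d
   outside these ranges play no role. The bound on the cardinality says K >= 1. *)
locale p_center =
  fixes N M p :: nat and d :: "nat \<Rightarrow> nat \<Rightarrow> real"
  assumes N_pos: "N \<ge> 1" and M_pos: "M \<ge> 1" and p_pos: "p \<ge> 1"
    and dist_nonneg: "\<And>i j. i \<in> {1..N} \<Longrightarrow> j \<in> {1..M} \<Longrightarrow> d i j \<ge> 0"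
    and two_distances: "card {d i j | i j. i \<in> {1..N} \<and> j \<in> {1..M}} \<ge> 2"
begin

definition distances :: "real set" where
  "distances = {d i j | i j. i \<in> {1..N} \<and> j \<in> {1..M}}"

definition K :: nat where
  "K = card distances - 1"

definition D :: "nat \<Rightarrow> real" where
  "D k = sorted_list_of_set distances ! k"

definition near :: "nat \<Rightarrow> nat \<Rightarrow> nat set" where
  "near i k = {j \<in> {1..M}. d i j < D k}"

definition S :: "nat \<Rightarrow> nat set" where
  "S i = {k \<in> {1..K - 1}. near i k \<noteq> near i (k + 1)}"

definition objective :: "(nat \<Rightarrow> real) \<Rightarrow> real" where
  "objective z = D 0 + (\<Sum>k = 1..K. (D k - D (k - 1)) * z k)"

(* A point is a pair (y, z), of which only the entries y j with j in {1..M} and z k with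
   k in {1..K} matter. The argument X is the domain of each variable: the feasible set of the
   0-1 program is obtained for X = {0, 1}, that of its linear relaxation for X = {0..1}. *)
definition P2 :: "real set \<Rightarrow> ((nat \<Rightarrow> real) \<times> (nat \<Rightarrow> real)) set" where
  "P2 X = {(y, z).
     1 \<le> (\<Sum>j = 1..M. y j) \<and> (\<Sum>j = 1..M. y j) \<le> real p \<and>
     (\<forall>i \<in> {1..N}. \<forall>k \<in> {1..K}. z k + (\<Sum>j \<in> near i k. y j) \<ge> 1) \<and>
     (\<forall>j \<in> {1..M}. y j \<in> X) \<and> (\<forall>k \<in> {1..K}. z k \<in> X)}"

definition CP1 :: "real set \<Rightarrow> ((nat \<Rightarrow> real) \<times> (nat \<Rightarrow> real)) set" where
  "CP1 X = {(y, z).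
     1 \<le> (\<Sum>j = 1..M. y j) \<and> (\<Sum>j = 1..M. y j) \<le> real p \<and>
     (\<forall>k \<in> {1..K - 1}. z k \<ge> z (k + 1)) \<and>
     (\<forall>i \<in> {1..N}. \<forall>k \<in> S i \<union> {K}. z k + (\<Sum>j \<in> near i k. y j) \<ge> 1) \<and>
     (\<forall>j \<in> {1..M}. y j \<in> X) \<and> (\<forall>k \<in> {1..K}. z k \<in> X)}"

(* The infimum is taken in the extended reals, so that an empty feasible set or an unbounded
   objective would give \<infinity> or -\<infinity> rather than an arbitrary real number. *)
definition opt_value :: "((nat \<Rightarrow> real) \<times> (nat \<Rightarrow> real)) set \<Rightarrow> ereal" where
  "opt_value F = (INF (y, z) \<in> F. ereal (objective z))"

lemma finite_distances: "finite distances"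
proof -
  have "distances = (\<lambda>(i, j). d i j) ` ({1..N} \<times> {1..M})"
    unfolding distances_def by (force simp: image_iff)
  then show ?thesis by simp
qed

lemma K_pos: "K \<ge> 1"
  using two_distances by (simp add: K_def distances_def)

lemma D_image: "D ` {0..K} = distances"
proof -
  have "card distances = Suc K"
    using K_pos by (simp add: K_def)
  then have "{0..K} = {..<length (sorted_list_of_set distances)}"
    by auto
  then have "D ` {0..K} = set (sorted_list_of_set distances)"
    by (auto simp: D_def set_conv_nth image_iff)
  then show ?thesis using finite_distances by simp
qed

lemma D_strict_mono: "strict_mono_on {0..K} D"
proof (rule strict_mono_onI)
  fix k l assume "k \<in> {0..K}" "l \<in> {0..K}" "k < l"
  moreover have "card distances = Suc K"
    using K_pos by (simp add: K_def)
  ultimately show "D k < D l"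
    unfolding D_def
    by (intro sorted_wrt_nth_less[OF strict_sorted_list_of_set]) auto
qed

end

end

(* Every point of the relaxation of CP1 is feasible for that of P2, since along a run of equal
   sets near i k the constraint is inherited from the end of the run by monotonicity of z.
   Conversely, replacing z by its running minimum turns a point of the relaxation of P2 into one
   of CP1 without increasing the objective: near i k grows with k and y is nonnegative. *)
theory Submission
  imports Defs
begin

context p_center
begin

lemma near_mono:
  assumes "k \<le> l" "l \<le> K"
  shows "near i k \<subseteq> near i l"
proof -
  have "D k \<le> D l"
    using assms strict_mono_on_leD[OF D_strict_mono] by simp
  then show ?thesis by (auto simp: near_def)
qed

lemma CP1_subset_P2: "CP1 X \<subseteq> P2 X"
proof (rule subrelI)
  fix y z assume feasible: "(y, z) \<in> CP1 X"
  have "z k + sum y (near i k) \<ge> 1" if i: "i \<in> {1..N}" and "k \<le> K" "1 \<le> k" for i k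
    using that(2,3)
  \<comment> \<open>Descending from \<open>K\<close>: the last run of equal sets has no end in
    \<open>S i\<close>, so the constraint imposed at \<open>K\<close> starts the induction.\<close>
  proof (induction k rule: inc_induct)
    case base
    then show ?case using feasible i by (simp add: CP1_def)
  next
    case (step k)
    show ?case
    proof (cases "k \<in> S i")
      case True
      then show ?thesis using feasible i by (simp add: CP1_def)
    next
      case False
      have "k \<in> {1..K - 1}" using step by auto
      then have "near i k = near i (Suc k)" "z (Suc k) \<le> z k"
        using False feasible by (auto simp: S_def CP1_def)
      then show ?thesis using step by simp
    qed
  qed
  then show "(y, z) \<in> P2 X"
    using feasible by (auto simp: CP1_def P2_def)
qed

text \<open>\<open>X\<close> need not be an interval: the minimum of finitely many values is one of
  them, so the new entries stay in \<open>X\<close>. Nonnegativity of \<open>X\<close> is what makes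
  sums of \<open>y\<close> grow with the index set.\<close>

lemma running_min_feasible:
  assumes feasible: "(y, z) \<in> P2 X" and X: "X \<subseteq> {0..}"
  shows "(y, \<lambda>k. Min (z ` {1..k})) \<in> CP1 X"
proof -
  have attained: "\<exists>l \<in> {1..k}. Min (z ` {1..k}) = z l" if "1 \<le> k" for k
  proof -
    have "Min (z ` {1..k}) \<in> z ` {1..k}" using that by (intro Min_in) auto
    then show ?thesis by blast
  qed
  have "Min (z ` {1..k}) + sum y (near i k) \<ge> 1" if "i \<in> {1..N}" "k \<in> {1..K}" for i k
  proof -
    \<comment> \<open>The constraint at an index \<open>l \<le> k\<close> attaining the minimum
      yields the one at \<open>k\<close>.\<close>
    obtain l where l: "l \<in> {1..k}" "Min (z ` {1..k}) = z l"
      using attained[of k] \<open>k \<in> {1..K}\<close> by auto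
    have "1 \<le> z l + sum y (near i l)"
      using feasible l that by (auto simp: P2_def)
    also have "sum y (near i l) \<le> sum y (near i k)"
      using feasible X l that by (intro sum_mono2 near_mono) (auto simp: P2_def near_def)
    finally show ?thesis using l by simp
  qed
  moreover have "k \<in> {1..K}" if "k \<in> S i \<union> {K}" for i k
    using that K_pos by (auto simp: S_def)
  moreover have "Min (z ` {1..k + 1}) \<le> Min (z ` {1..k})" if "k \<in> {1..K - 1}" for k
    using that by (intro Min_antimono) auto
  moreover have "Min (z ` {1..k}) \<in> X" if "k \<in> {1..K}" for k
    using attained[of k] that feasible by (fastforce simp: P2_def)
  ultimately show ?thesis
    using feasible unfolding CP1_def P2_def by blast
qed

text \<open>The coefficients are gaps between consecutive values of the increasing \<open>D\<close>,
  hence nonnegative.\<close>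

lemma objective_mono:
  assumes "\<And>k. k \<in> {1..K} \<Longrightarrow> z k \<le> z' k"
  shows "objective z \<le> objective z'"
proof -
  have "D (k - 1) \<le> D k" if "k \<in> {1..K}" for k
    using that strict_mono_on_leD[OF D_strict_mono, of "k - 1" k] by auto
  then show ?thesis
    using assms by (auto simp: objective_def intro!: sum_mono mult_left_mono)
qed

text \<open>A general domain \<open>X\<close> covers both the 0-1 programs and their
  relaxations.\<close>

lemma opt_value_CP1_eq_P2:
  assumes "X \<subseteq> {0..}"
  shows "opt_value (CP1 X) = opt_value (P2 X)"
proof (rule antisym)
  have "\<exists>x' \<in> CP1 X. objective (snd x') \<le> objective (snd x)" if "x \<in> P2 X" for x
    using that running_min_feasible[OF _ assms, of "fst x" "snd x"]
    \<comment> \<open>The range \<open>{1..k}\<close> contains \<open>k\<close> itself, so the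
      running minimum is pointwise at most the original \<open>z\<close>.\<close>
    by (intro bexI[of _ "(fst x, \<lambda>k. Min (snd x ` {1..k}))"] objective_mono) auto
  then show "opt_value (CP1 X) \<le> opt_value (P2 X)"
    by (auto simp: opt_value_def case_prod_unfold intro!: INF_mono)
  show "opt_value (P2 X) \<le> opt_value (CP1 X)"
    unfolding opt_value_def by (rule INF_superset_mono[OF CP1_subset_P2]) simp
qed

end

theorem proposition3:
  fixes N M p :: nat and d :: "nat \<Rightarrow> nat \<Rightarrow> real"
  assumes "p_center N M p d"
  shows "p_center.opt_value N M d (p_center.CP1 N M p d {0..1}) =
         p_center.opt_value N M d (p_center.P2 N M p d {0..1})"
  by (rule p_center.opt_value_CP1_eq_P2[OF assms]) auto

end
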